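(* Let $k\ge 2$ be a fixed integer. There exist a lawless group $\Gamma$ generated by a finite set $S$ and a constant $c>0$ such that $\mathcal{A}_{\Gamma}^S (n) \geq c\, n$ for all $n\in\mathbb{N}$, where $\mathcal{A}_\Gamma^S$ is the lawlessness growth function of $\Gamma$ (defined using words in $F_k$).
   Context: $\mathbb{N}=\{1,2,\dots\}$. For a group $\Gamma$ with finite generating set $S$, $|g|_S$ denotes the word length of $g\in\Gamma$ with respect to $S$ (letters from $S\cup S^{-1}$). $F_k$ is the free group on $x_1,\dots,x_k$ and $|w|$ is the reduced length of $w\in F_k$. For $w\in F_k$ and $\mathbf g=(g_1,\dots,g_k)\in\Gamma^k$, $w(\mathbf g)$ is the image of $w$ under the homomorphism $F_k\to\Gamma$, $x_i\mapsto g_i$. A law for $\Gamma$ is a nontrivial $w$ in some $F_k$ with $w(\mathbf g)=1$ for all $\mathbf g\in\Gamma^k$; $\Gamma$ is lawless if it has no laws. For $\Gamma$ lawless and $1\neq w\in F_k$, the complexity is $\chi_\Gamma^S(w)=\min\{\sum_{i=1}^k|g_i|_S : \mathbf g\in\Gamma^k,\ w(\mathbf g)\neq 1\}$, and the lawlessness growth function is $\mathcal A_\Gamma^S(n)=\max\{\chi_\Gamma^S(w) : 1\neq w\in F_k,\ |w|\le n\}$, where the rank $k\ge 2$ is fixed. *)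

theory Defs
  imports Complex_Main "HOL-Algebra.Generated_Groups"
begin

text \<open>The free generators are indexed by \<open>0, \<dots>, k - 1\<close>.
  The letter \<open>(i, True)\<close> stands for the generator with index \<open>i\<close> and
  \<open>(i, False)\<close> for its inverse. Elements of the free group are reduced words, so the
  reduced length of an element is the length of the list.\<close>

type_synonym letter = "nat \<times> bool"

definition inv_letter :: "letter \<Rightarrow> letter" where
  "inv_letter l = (fst l, \<not> snd l)"

definition reduced :: "letter list \<Rightarrow> bool" where
  "reduced w \<longleftrightarrow> successively (\<lambda>l m. m \<noteq> inv_letter l) w"

definition push_letter :: "letter \<Rightarrow> letter list \<Rightarrow> letter list" where
  "push_letter l w =
     (case w of [] \<Rightarrow> [l] | m # v \<Rightarrow> if m = inv_letter l then v else l # w)"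

text \<open>Multiplication is concatenation followed by free reduction.\<close>

definition free_group :: "nat \<Rightarrow> letter list monoid" where
  "free_group k =
     \<lparr> carrier = {w. set w \<subseteq> {..<k} \<times> UNIV \<and> reduced w},
       mult = (\<lambda>u v. foldr push_letter u v),
       one = [] \<rparr>"

definition eval_letter :: "('a, 'b) monoid_scheme \<Rightarrow> (nat \<Rightarrow> 'a) \<Rightarrow> letter \<Rightarrow> 'a" where
  "eval_letter G g l = (if snd l then g (fst l) else inv\<^bsub>G\<^esub> (g (fst l)))"

text \<open>The value \<open>w(g)\<close>; \<open>word_eval_hom\<close>, \<open>word_eval_generator\<close> and
  \<open>word_eval_unique\<close> below show that this is the image of \<open>w\<close> under the unique
  homomorphism sending the generator with index \<open>i\<close> to \<open>g i\<close>.\<close>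

definition word_eval :: "('a, 'b) monoid_scheme \<Rightarrow> (nat \<Rightarrow> 'a) \<Rightarrow> letter list \<Rightarrow> 'a" where
  "word_eval G g w = foldr (\<lambda>l x. eval_letter G g l \<otimes>\<^bsub>G\<^esub> x) w \<one>\<^bsub>G\<^esub>"

text \<open>\<open>k\<close>-tuples in \<open>G\<close> are the elements of
  \<open>{..<k} \<rightarrow>\<^sub>E carrier G\<close>.\<close>

definition is_law :: "('a, 'b) monoid_scheme \<Rightarrow> nat \<Rightarrow> letter list \<Rightarrow> bool" where
  "is_law G k w \<longleftrightarrow>
     w \<in> carrier (free_group k) \<and> w \<noteq> \<one>\<^bsub>free_group k\<^esub> \<and>
     (\<forall>g \<in> {..<k} \<rightarrow>\<^sub>E carrier G. word_eval G g w = \<one>\<^bsub>G\<^esub>)"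

definition lawless :: "('a, 'b) monoid_scheme \<Rightarrow> bool" where
  "lawless G \<longleftrightarrow> \<not> (\<exists>k w. is_law G k w)"

text \<open>The minimum is attained whenever \<open>S\<close> generates \<open>G\<close>
  and \<open>x \<in> carrier G\<close>.\<close>

definition word_length :: "('a, 'b) monoid_scheme \<Rightarrow> 'a set \<Rightarrow> 'a \<Rightarrow> nat" where
  "word_length G S x =
     (LEAST n. \<exists>xs. length xs = n \<and> set xs \<subseteq> S \<union> (\<lambda>s. inv\<^bsub>G\<^esub> s) ` S \<and>
                    foldr (\<lambda>y z. y \<otimes>\<^bsub>G\<^esub> z) xs \<one>\<^bsub>G\<^esub> = x)"

text \<open>The minimum is attained whenever \<open>G\<close> is lawless and \<open>w\<close> is a nontrivial
  element of \<open>free_group k\<close>.\<close>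

definition complexity :: "('a, 'b) monoid_scheme \<Rightarrow> 'a set \<Rightarrow> nat \<Rightarrow> letter list \<Rightarrow> nat" where
  "complexity G S k w =
     (LEAST m. \<exists>g \<in> {..<k} \<rightarrow>\<^sub>E carrier G.
        word_eval G g w \<noteq> \<one>\<^bsub>G\<^esub> \<and> m = (\<Sum>i<k. word_length G S (g i)))"

text \<open>For \<open>k \<ge> 1\<close> and \<open>n \<ge> 1\<close> the maximum is over a finite nonempty set.\<close>

definition lawlessness_growth :: "('a, 'b) monoid_scheme \<Rightarrow> 'a set \<Rightarrow> nat \<Rightarrow> nat \<Rightarrow> nat" where
  "lawlessness_growth G S k n =
     Max {complexity G S k w | w.
            w \<in> carrier (free_group k) \<and> w \<noteq> \<one>\<^bsub>free_group k\<^esub> \<and> length w \<le> n}"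

lemma inv_letter_inv_letter [simp]: "inv_letter (inv_letter l) = l"
  by (simp add: inv_letter_def)

lemma inv_letter_eq_iff [simp]: "inv_letter l = inv_letter m \<longleftrightarrow> l = m"
  by (metis inv_letter_inv_letter)

lemma fst_inv_letter [simp]: "fst (inv_letter l) = fst l"
  by (simp add: inv_letter_def)

lemma inv_letter_mem_iff: "inv_letter l \<in> A \<times> UNIV \<longleftrightarrow> l \<in> A \<times> UNIV"
  by (cases l) (auto simp: inv_letter_def)

lemma reduced_Nil [simp]: "reduced []"
  by (simp add: reduced_def)

lemma reduced_Cons:
  "reduced (l # w) \<longleftrightarrow> reduced w \<and> (w \<noteq> [] \<longrightarrow> hd w \<noteq> inv_letter l)"
  by (cases w) (auto simp: reduced_def)

lemma reduced_push: "reduced w \<Longrightarrow> reduced (push_letter l w)"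
  by (cases w) (auto simp: push_letter_def reduced_Cons)

lemma reduced_foldr_push: "reduced w \<Longrightarrow> reduced (foldr push_letter u w)"
  by (induction u) (auto simp: reduced_push)

lemma set_push: "set (push_letter l w) \<subseteq> insert l (set w)"
  by (cases w) (auto simp: push_letter_def)

lemma set_foldr_push: "set (foldr push_letter u w) \<subseteq> set u \<union> set w"
  by (induction u) (use set_push in fastforce)+

lemma push_push_inv: "reduced w \<Longrightarrow> push_letter l (push_letter (inv_letter l) w) = w"
  by (cases w; cases "tl w") (auto simp: push_letter_def reduced_Cons)

lemma foldr_push_push:
  assumes "reduced v" "reduced w"
  shows "foldr push_letter (push_letter l v) w = push_letter l (foldr push_letter v w)"
proof (cases "v \<noteq> [] \<and> hd v = inv_letter l")
  case True
  then obtain u where "v = inv_letter l # u" by (cases v) auto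
  then show ?thesis
    using assms push_push_inv[OF reduced_foldr_push[OF assms(2)], of l u]
    by (simp add: push_letter_def[of l "inv_letter l # u"])
next
  case False
  then have "push_letter l v = l # v" by (cases v) (auto simp: push_letter_def)
  then show ?thesis by simp
qed

lemma foldr_push_assoc:
  assumes "reduced v" "reduced w"
  shows "foldr push_letter (foldr push_letter u v) w
       = foldr push_letter u (foldr push_letter v w)"
  using assms by (induction u) (auto simp: foldr_push_push reduced_foldr_push)

lemma foldr_push_inverse:
  "foldr push_letter (rev (map inv_letter u)) u = []"
  by (induction u) (auto simp: push_letter_def)

lemma reduced_inverse: "reduced u \<Longrightarrow> reduced (rev (map inv_letter u))"
  unfolding reduced_def successively_rev successively_map
  by (erule successively_mono) (metis inv_letter_inv_letter)

lemma group_free_group: "group (free_group k)"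
proof (rule groupI)
  fix x assume x: "x \<in> carrier (free_group k)"
  show "\<exists>y\<in>carrier (free_group k). y \<otimes>\<^bsub>free_group k\<^esub> x = \<one>\<^bsub>free_group k\<^esub>"
  proof (rule bexI)
    show "rev (map inv_letter x) \<otimes>\<^bsub>free_group k\<^esub> x = \<one>\<^bsub>free_group k\<^esub>"
      by (simp add: free_group_def foldr_push_inverse)
    show "rev (map inv_letter x) \<in> carrier (free_group k)"
      using x by (auto simp: free_group_def reduced_inverse inv_letter_def)
  qed
next
  fix x y assume "x \<in> carrier (free_group k)" "y \<in> carrier (free_group k)"
  then show "x \<otimes>\<^bsub>free_group k\<^esub> y \<in> carrier (free_group k)"
    using set_foldr_push[of x y] by (auto simp: free_group_def reduced_foldr_push)
qed (auto simp: free_group_def foldr_push_assoc)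

lemma eval_letter_closed:
  assumes "group G" "g \<in> {..<k} \<rightarrow> carrier G" "l \<in> {..<k} \<times> UNIV"
  shows "eval_letter G g l \<in> carrier G"
proof -
  interpret group G by fact
  have "g (fst l) \<in> carrier G" using assms(2,3) by (cases l) auto
  then show ?thesis by (simp add: eval_letter_def)
qed

lemma word_eval_Nil [simp]: "word_eval G g [] = \<one>\<^bsub>G\<^esub>"
  by (simp add: word_eval_def)

lemma word_eval_Cons [simp]:
  "word_eval G g (l # w) = eval_letter G g l \<otimes>\<^bsub>G\<^esub> word_eval G g w"
  by (simp add: word_eval_def)

lemma word_eval_closed:
  assumes "group G" "g \<in> {..<k} \<rightarrow> carrier G" "set w \<subseteq> {..<k} \<times> UNIV"
  shows "word_eval G g w \<in> carrier G"
proof -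
  interpret group G by fact
  show ?thesis using assms(3)
    by (induction w) (use eval_letter_closed[OF assms(1,2)] in auto)
qed

lemma eval_letter_inv_letter:
  assumes "group G" "g \<in> {..<k} \<rightarrow> carrier G" "l \<in> {..<k} \<times> UNIV"
  shows "eval_letter G g (inv_letter l) = inv\<^bsub>G\<^esub> (eval_letter G g l)"
proof -
  interpret group G by fact
  have "g (fst l) \<in> carrier G" using assms(2,3) by (cases l) auto
  then show ?thesis by (simp add: eval_letter_def inv_letter_def)
qed

lemma word_eval_push:
  assumes "group G" "g \<in> {..<k} \<rightarrow> carrier G" "l \<in> {..<k} \<times> UNIV"
    "set w \<subseteq> {..<k} \<times> UNIV"
  shows "word_eval G g (push_letter l w) = eval_letter G g l \<otimes>\<^bsub>G\<^esub> word_eval G g w"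
proof (cases "w \<noteq> [] \<and> hd w = inv_letter l")
  case True
  interpret group G by fact
  from True obtain v where w: "w = inv_letter l # v" by (cases w) auto
  have "eval_letter G g l \<in> carrier G" by (rule eval_letter_closed[OF assms(1-3)])
  moreover have "word_eval G g v \<in> carrier G"
    using word_eval_closed[OF assms(1,2)] assms(4) w by simp
  ultimately show ?thesis
    using w eval_letter_inv_letter[OF assms(1-3)]
    by (simp add: push_letter_def inv_solve_left m_assoc[symmetric])
next
  case False
  then show ?thesis by (cases w) (auto simp: push_letter_def)
qed

lemma word_eval_hom:
  assumes "group G" "g \<in> {..<k} \<rightarrow> carrier G"
  shows "word_eval G g \<in> hom (free_group k) G"
proof -
  interpret group G by fact
  have "word_eval G g (foldr push_letter u v) = word_eval G g u \<otimes>\<^bsub>G\<^esub> word_eval G g v"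
    if "set u \<subseteq> {..<k} \<times> UNIV" "set v \<subseteq> {..<k} \<times> UNIV" for u v
    using that
  proof (induction u)
    case Nil
    then show ?case using word_eval_closed[OF assms] by simp
  next
    case (Cons l u)
    have "set (foldr push_letter u v) \<subseteq> {..<k} \<times> UNIV"
      using set_foldr_push[of u v] Cons.prems by auto
    moreover have "l \<in> {..<k} \<times> UNIV" using Cons.prems by simp
    ultimately show ?case
      using Cons word_eval_closed[OF assms] eval_letter_closed[OF assms]
      by (simp add: word_eval_push[OF assms] m_assoc)
  qed
  then show ?thesis
    using word_eval_closed[OF assms] by (auto simp: hom_def free_group_def)
qed

lemma word_eval_generator:
  assumes "group G" "g i \<in> carrier G"
  shows "word_eval G g [(i, True)] = g i"
proof -
  interpret group G by fact
  show ?thesis using assms(2) by (simp add: eval_letter_def)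
qed

lemma word_eval_unique:
  assumes "group G" "h \<in> hom (free_group k) G" "w \<in> carrier (free_group k)"
  shows "h w = word_eval G (\<lambda>i. h [(i, True)]) w"
proof -
  interpret F: group "free_group k" by (rule group_free_group)
  interpret group_hom "free_group k" G h
    using assms group_free_group by (simp add: group_hom_def group_hom_axioms_def)
  have letter: "h [l] = eval_letter G (\<lambda>i. h [(i, True)]) l" if l: "fst l < k" for l
  proof (cases "snd l")
    case True
    then show ?thesis by (cases l) (simp add: eval_letter_def)
  next
    case False
    have "[l] = inv\<^bsub>free_group k\<^esub> [(fst l, True)]"
      by (rule F.inv_equality[symmetric])
        (use l False in \<open>cases l; auto simp: free_group_def push_letter_def inv_letter_def reduced_Cons\<close>)+
    then have "h [l] = h (inv\<^bsub>free_group k\<^esub> [(fst l, True)])" by simp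
    also have "\<dots> = inv\<^bsub>G\<^esub> (h [(fst l, True)])"
      by (rule hom_inv) (use l in \<open>auto simp: free_group_def reduced_Cons\<close>)
    finally show ?thesis using False by (simp add: eval_letter_def)
  qed
  from assms(3) show ?thesis
  proof (induction w)
    case Nil
    then show ?case using hom_one by (simp add: free_group_def)
  next
    case (Cons l w)
    have l: "[l] \<in> carrier (free_group k)" and w: "w \<in> carrier (free_group k)"
      and lw: "[l] \<otimes>\<^bsub>free_group k\<^esub> w = l # w"
      using Cons.prems
      by (auto simp: free_group_def reduced_Cons push_letter_def split: list.split)
    have "h (l # w) = h [l] \<otimes>\<^bsub>G\<^esub> h w" using hom_mult[OF l w] lw by simp
    moreover have "fst l < k" using Cons.prems by (auto simp: free_group_def)
    ultimately show ?case using Cons.IH[OF w] letter by simp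
  qed
qed

end

theory Submission
  imports Defs "HOL-Library.Z2" "HOL-Library.Countable_Set"
begin

text \<open>Let \<open>\<Gamma>\<close> be generated by the shift \<open>t\<close> and one elementary transvection \<open>a\<close> acting on sequences
  \<open>\<int> \<rightarrow> GF(2)\<close>, so that \<open>\<Gamma>\<close> is the semidirect product of the finitary unitriangular group over
  \<open>GF(2)\<close> by \<open>\<int>\<close>. If \<open>g\<close> and \<open>h\<close> have total length \<open>R\<close>, their commutator is unitriangular and
  differs from the identity only in rows between \<open>-2R\<close> and \<open>2R\<close>, so its \<open>2\<^sup>m\<close>th power is trivial as
  soon as \<open>2\<^sup>m \<ge> 4R + 2\<close>. Thus the word \<open>[x\<^sub>0, x\<^sub>1]\<^bsup>2^m\<^esup>\<close>, of length \<open>4 \<cdot> 2\<^sup>m\<close>, has complexity of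
  order at least \<open>2\<^sup>m\<close>. On the other hand \<open>\<Gamma>\<close> is lawless, because in unitriangular matrices the letters of
  a given reduced word can be chosen to move a basis vector one step further along the basis each time.\<close>

section \<open>Shifts and transvections of sequences over GF(2)\<close>

declare add_bit_eq_xor [simp del]

lemma bit_add_self [simp]: "b + b = (0 :: bit)"
  by (cases b) (simp_all add: add_bit_eq_xor)

type_synonym seq = "int \<Rightarrow> bit"

definition shift :: "int \<Rightarrow> seq \<Rightarrow> seq" where
  "shift s x = (\<lambda>i. x (i - s))"

text \<open>The matrix is I plus the sum of the matrix units E_{j+1,j} over j in \<open>J\<close>.
  Allowing a whole set of positions lets a single involution act at every place where one letter
  occurs in a word.\<close>

definition transvections :: "int set \<Rightarrow> seq \<Rightarrow> seq" where
  "transvections J x = (\<lambda>i. x i + (if i - 1 \<in> J then x (i - 1) else 0))"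

lemma transvections_apply:
  "transvections J x i = x i + (if i - 1 \<in> J then x (i - 1) else 0)"
  by (simp add: transvections_def)

lemma shift_comp: "shift s \<circ> shift r = shift (s + r)"
  by (auto simp: shift_def fun_eq_iff algebra_simps)

lemma shift_0: "shift 0 = id"
  by (auto simp: shift_def)

lemma transvections_empty: "transvections {} = id"
  by (auto simp: transvections_def fun_eq_iff)

text \<open>Because \<open>j - 1 \<notin> J\<close>, the map \<open>transvections J\<close> keeps
  coordinate \<open>j\<close>, so the entry that \<open>transvections {j}\<close> then adds to
  coordinate \<open>j + 1\<close> is the original one.\<close>

lemma transvections_insert:
  assumes "j \<notin> J" "j - 1 \<notin> J"
  shows "transvections (insert j J) = transvections {j} \<circ> transvections J"
proof (intro ext)
  fix x i
  show "transvections (insert j J) x i = (transvections {j} \<circ> transvections J) x i"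
    using assms by (cases "i - 1 = j") (auto simp: transvections_def)
qed

text \<open>Conjugation by shifts carries the one chosen transvection to every position, which is
  why two generators suffice.\<close>

lemma transvections_singleton: "transvections {j} = shift j \<circ> transvections {0} \<circ> shift (- j)"
proof (intro ext)
  fix x i
  show "transvections {j} x i = (shift j \<circ> transvections {0} \<circ> shift (- j)) x i"
    by (cases "i - 1 = j") (auto simp: transvections_def shift_def)
qed

text \<open>When \<open>J\<close> has no two adjacent elements, the part N off the diagonal
  satisfies N^2 = 0, hence (1 + N)^2 = 1 + 2N = 1 in characteristic 2.\<close>

lemma transvections_involution:
  assumes "\<And>j. j \<in> J \<Longrightarrow> j - 1 \<notin> J"
  shows "transvections J \<circ> transvections J = id"
proof (intro ext)
  fix x i
  show "(transvections J \<circ> transvections J) x i = id x i"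
    using assms[of "i - 1"] by (auto simp: transvections_def add.assoc)
qed

section \<open>The group generated by the shift and one transvection\<close>

text \<open>A symmetric set, since the transvection is its own inverse; compositions of its elements
  therefore already form a group.\<close>

definition gens :: "(seq \<Rightarrow> seq) set" where
  "gens = {transvections {0}, shift 1, shift (- 1)}"

definition comp_list :: "('a \<Rightarrow> 'a) list \<Rightarrow> 'a \<Rightarrow> 'a" where
  "comp_list fs = foldr (\<circ>) fs id"

lemma comp_list_Nil [simp]: "comp_list [] = id"
  by (simp add: comp_list_def)

lemma comp_list_Cons [simp]: "comp_list (f # fs) = f \<circ> comp_list fs"
  by (simp add: comp_list_def)

definition maps :: "(seq \<Rightarrow> seq) set" where
  "maps = (\<lambda>fs. comp_list fs) ` lists gens"

lemma comp_list_append: "comp_list (fs @ gs) = comp_list fs \<circ> comp_list gs"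
  by (induction fs) (auto simp: comp_assoc)

lemma id_in_maps: "id \<in> maps"
  unfolding maps_def by (rule image_eqI[of _ _ "[]"]) auto

lemma comp_in_maps:
  assumes "f \<in> maps" "g \<in> maps"
  shows "f \<circ> g \<in> maps"
proof -
  obtain fs gs where "f = comp_list fs" "fs \<in> lists gens" "g = comp_list gs" "gs \<in> lists gens"
    using assms unfolding maps_def by blast
  then show ?thesis
    unfolding maps_def by (intro image_eqI[of _ _ "fs @ gs"]) (auto simp: comp_list_append)
qed

lemma gens_in_maps: "f \<in> gens \<Longrightarrow> f \<in> maps"
  unfolding maps_def by (rule image_eqI[of _ _ "[f]"]) auto

lemma maps_inverse:
  assumes "f \<in> maps"
  shows "\<exists>g \<in> maps. g \<circ> f = id \<and> f \<circ> g = id"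
proof -
  obtain fs where fs: "fs \<in> lists gens" "f = comp_list fs"
    using assms unfolding maps_def by blast
  have gen: "\<exists>g' \<in> gens. g' \<circ> g = id \<and> g \<circ> g' = id" if "g \<in> gens" for g
    using that transvections_involution[of "{0}"]
    by (auto simp: gens_def shift_comp shift_0)
  from fs(1) have "\<exists>g \<in> maps. g \<circ> comp_list fs = id \<and> comp_list fs \<circ> g = id"
  proof (induction fs)
    case Nil
    show ?case by (rule bexI[OF _ id_in_maps]) simp
  next
    case (Cons a fs)
    then obtain g where g: "g \<in> maps" "g \<circ> comp_list fs = id" "comp_list fs \<circ> g = id"
      by blast
    obtain b where b: "b \<in> gens" "b \<circ> a = id" "a \<circ> b = id"
      using gen[OF Cons.hyps(1)] by (elim bexE conjE) (rule that)
    have "g \<circ> b \<in> maps" by (rule comp_in_maps[OF g(1) gens_in_maps[OF b(1)]])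
    moreover have "(g \<circ> b) \<circ> comp_list (a # fs) = id" "comp_list (a # fs) \<circ> (g \<circ> b) = id"
      by (rule ext, simp add: pointfree_idE[OF g(2)] pointfree_idE[OF g(3)]
          pointfree_idE[OF b(2)] pointfree_idE[OF b(3)])+
    ultimately show ?case by metis
  qed
  then show ?thesis using fs by simp
qed

lemma countable_maps: "countable maps"
  unfolding maps_def gens_def by (intro countable_image countable_lists) simp

lemma shift_in_maps: "shift s \<in> maps"
proof -
  have "shift (int n) \<in> maps" "shift (- int n) \<in> maps" for n
  proof (induction n)
    case (Suc n)
    have "shift 1 \<in> maps" "shift (- 1) \<in> maps" by (auto intro: gens_in_maps simp: gens_def)
    then have "shift 1 \<circ> shift (int n) \<in> maps" "shift (- 1) \<circ> shift (- int n) \<in> maps"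
      using Suc comp_in_maps by blast+
    moreover have "1 + int n = int (Suc n)" "- 1 + - int n = - int (Suc n)" by auto
    ultimately show "shift (int (Suc n)) \<in> maps" "shift (- int (Suc n)) \<in> maps"
      unfolding shift_comp by metis+
  qed (simp_all add: shift_0 id_in_maps)
  then show ?thesis by (cases s rule: int_cases2) auto
qed

text \<open>One position is split off at a time; each single transvection is a conjugate of the
  generator by a shift.\<close>

lemma transvections_in_maps:
  assumes "finite J" "\<And>j. j \<in> J \<Longrightarrow> j - 1 \<notin> J"
  shows "transvections J \<in> maps"
  using assms
proof (induction J rule: finite_induct)
  case empty
  show ?case unfolding transvections_empty by (rule id_in_maps)
next
  case (insert j J)
  have "transvections {0} \<in> maps" by (auto intro: gens_in_maps simp: gens_def)
  then have "transvections {j} \<in> maps"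
    unfolding transvections_singleton[of j] by (intro comp_in_maps shift_in_maps)
  moreover have "transvections J \<in> maps" using insert by auto
  moreover have "j - 1 \<notin> J" using insert.prems by auto
  ultimately show ?case
    using insert transvections_insert[of j J] comp_in_maps by presburger
qed

section \<open>Transport to a group on the natural numbers\<close>

abbreviation enc :: "(seq \<Rightarrow> seq) \<Rightarrow> nat" where
  "enc \<equiv> to_nat_on maps"

abbreviation dec :: "nat \<Rightarrow> seq \<Rightarrow> seq" where
  "dec \<equiv> from_nat_into maps"

text \<open>The group has to live on \<open>nat\<close>. Since \<open>maps\<close> is countable,
  composition is transported along \<open>enc\<close>, which is injective on
  \<open>maps\<close>.\<close>

definition shift_group :: "nat monoid" where
  "shift_group = \<lparr>carrier = enc ` maps, mult = (\<lambda>x y. enc (dec x \<circ> dec y)), one = enc id\<rparr>"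

definition shift_gens :: "nat set" where
  "shift_gens = {enc (transvections {0}), enc (shift 1)}"

lemma dec_enc [simp]: "f \<in> maps \<Longrightarrow> dec (enc f) = f"
  by (rule from_nat_into_to_nat_on[OF countable_maps])

lemma dec_in_maps: "x \<in> carrier shift_group \<Longrightarrow> dec x \<in> maps"
  by (auto simp: shift_group_def)

lemma enc_dec: "x \<in> carrier shift_group \<Longrightarrow> enc (dec x) = x"
  by (auto simp: shift_group_def)

lemma enc_in_carrier [simp]: "f \<in> maps \<Longrightarrow> enc f \<in> carrier shift_group"
  by (auto simp: shift_group_def)

lemma dec_one: "dec \<one>\<^bsub>shift_group\<^esub> = id"
  by (simp add: shift_group_def id_in_maps)

lemma dec_mult:
  "x \<in> carrier shift_group \<Longrightarrow> y \<in> carrier shift_group \<Longrightarrow>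
    dec (x \<otimes>\<^bsub>shift_group\<^esub> y) = dec x \<circ> dec y"
  by (auto simp: shift_group_def comp_in_maps)

lemma enc_mult:
  "f \<in> maps \<Longrightarrow> g \<in> maps \<Longrightarrow> enc f \<otimes>\<^bsub>shift_group\<^esub> enc g = enc (f \<circ> g)"
  by (simp add: shift_group_def)

lemma dec_inject:
  "x \<in> carrier shift_group \<Longrightarrow> y \<in> carrier shift_group \<Longrightarrow> dec x = dec y \<longleftrightarrow> x = y"
  by (metis enc_dec)

lemma mult_in_shift_group:
  "x \<in> carrier shift_group \<Longrightarrow> y \<in> carrier shift_group \<Longrightarrow>
    x \<otimes>\<^bsub>shift_group\<^esub> y \<in> carrier shift_group"
  using comp_in_maps by (fastforce simp: shift_group_def)

interpretation sg: group shift_group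
proof (rule groupI)
  show one: "\<one>\<^bsub>shift_group\<^esub> \<in> carrier shift_group"
    by (simp add: shift_group_def id_in_maps)
  fix x assume x: "x \<in> carrier shift_group"
  show "\<one>\<^bsub>shift_group\<^esub> \<otimes>\<^bsub>shift_group\<^esub> x = x"
    using x one by (simp add: dec_inject[symmetric] mult_in_shift_group dec_mult dec_one)
  obtain g where "g \<in> maps" "g \<circ> dec x = id" using maps_inverse[OF dec_in_maps[OF x]] by auto
  then show "\<exists>y\<in>carrier shift_group. y \<otimes>\<^bsub>shift_group\<^esub> x = \<one>\<^bsub>shift_group\<^esub>"
    by (intro bexI[of _ "enc g"]) (auto simp: shift_group_def)
  fix y assume y: "y \<in> carrier shift_group"
  show "x \<otimes>\<^bsub>shift_group\<^esub> y \<in> carrier shift_group" using x y by (rule mult_in_shift_group)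
  fix z assume z: "z \<in> carrier shift_group"
  show "x \<otimes>\<^bsub>shift_group\<^esub> y \<otimes>\<^bsub>shift_group\<^esub> z = x \<otimes>\<^bsub>shift_group\<^esub> (y \<otimes>\<^bsub>shift_group\<^esub> z)"
    using x y z by (simp add: dec_inject[symmetric] mult_in_shift_group dec_mult comp_assoc)
qed

lemma enc_inv:
  assumes "f \<in> maps" "g \<in> maps" "g \<circ> f = id"
  shows "inv\<^bsub>shift_group\<^esub> (enc f) = enc g"
proof (rule sg.inv_equality)
  show "enc g \<otimes>\<^bsub>shift_group\<^esub> enc f = \<one>\<^bsub>shift_group\<^esub>"
    using assms by (simp add: enc_mult) (simp add: shift_group_def)
qed (use assms in auto)

lemma dec_inv:
  assumes "f \<in> maps" "g \<in> maps" "g \<circ> f = id"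
  shows "dec (inv\<^bsub>shift_group\<^esub> (enc f)) = g"
  using assms by (simp add: enc_inv)

section \<open>Generators, spellings and word length\<close>

lemma enc_shift_inverse: "inv\<^bsub>shift_group\<^esub> (enc (shift 1)) = enc (shift (- 1))"
  by (rule enc_inv) (auto simp: shift_in_maps shift_comp shift_0)

lemma enc_transvection_inverse:
  "inv\<^bsub>shift_group\<^esub> (enc (transvections {0})) = enc (transvections {0})"
  by (rule enc_inv) (auto intro!: transvections_in_maps transvections_involution)

text \<open>Identifies the alphabet used by \<open>word_length\<close>, so that spellings become
  lists over \<open>gens\<close>.\<close>

lemma symmetric_gens:
  "shift_gens \<union> (\<lambda>s. inv\<^bsub>shift_group\<^esub> s) ` shift_gens = enc ` gens"
  by (auto simp: shift_gens_def gens_def enc_shift_inverse enc_transvection_inverse)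

lemma shift_gens_subset: "shift_gens \<subseteq> carrier shift_group"
  unfolding shift_gens_def by (auto intro!: enc_in_carrier shift_in_maps transvections_in_maps)

lemma shift_group_spelling:
  assumes "x \<in> carrier shift_group"
  shows "\<exists>xs. set xs \<subseteq> enc ` gens \<and>
    foldr (\<lambda>y z. y \<otimes>\<^bsub>shift_group\<^esub> z) xs \<one>\<^bsub>shift_group\<^esub> = x"
proof -
  have *: "foldr (\<lambda>y z. y \<otimes>\<^bsub>shift_group\<^esub> z) (map enc fs) \<one>\<^bsub>shift_group\<^esub> = enc (comp_list fs)
      \<and> comp_list fs \<in> maps"
    if "fs \<in> lists gens" for fs
    using that
  proof induction
    case Nil
    have "foldr (\<lambda>y z. y \<otimes>\<^bsub>shift_group\<^esub> z) (map enc []) \<one>\<^bsub>shift_group\<^esub> = \<one>\<^bsub>shift_group\<^esub>"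
      by simp
    also have "\<dots> = enc id" by (simp add: shift_group_def)
    finally show ?case unfolding comp_list_Nil by (intro conjI id_in_maps)
  next
    case (Cons f fs)
    note f = gens_in_maps[OF Cons.hyps(1)] and fs = Cons.IH[THEN conjunct2]
    have "foldr (\<lambda>y z. y \<otimes>\<^bsub>shift_group\<^esub> z) (map enc (f # fs)) \<one>\<^bsub>shift_group\<^esub>
        = enc f \<otimes>\<^bsub>shift_group\<^esub> foldr (\<lambda>y z. y \<otimes>\<^bsub>shift_group\<^esub> z) (map enc fs) \<one>\<^bsub>shift_group\<^esub>"
      by simp
    also have "\<dots> = enc (f \<circ> comp_list fs)"
      unfolding Cons.IH[THEN conjunct1] by (rule enc_mult[OF f fs])
    finally show ?case unfolding comp_list_Cons by (rule conjI[OF _ comp_in_maps[OF f fs]])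
  qed
  obtain fs where fs: "fs \<in> lists gens" "x = enc (comp_list fs)"
    using assms by (auto simp: shift_group_def maps_def)
  have "set (map enc fs) \<subseteq> enc ` gens" using fs(1) by auto
  moreover have "foldr (\<lambda>y z. y \<otimes>\<^bsub>shift_group\<^esub> z) (map enc fs) \<one>\<^bsub>shift_group\<^esub> = x"
    unfolding fs(2) by (rule conjunct1[OF *[OF fs(1)]])
  ultimately show ?thesis by (intro exI conjI)
qed

lemma generate_shift_gens: "generate shift_group shift_gens = carrier shift_group"
proof
  show "generate shift_group shift_gens \<subseteq> carrier shift_group"
    by (rule sg.generate_incl[OF shift_gens_subset])
  have gen: "y \<in> generate shift_group shift_gens" if "y \<in> enc ` gens" for y
    using that unfolding symmetric_gens[symmetric]
    by (auto intro: generate.incl generate.inv)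
  show "carrier shift_group \<subseteq> generate shift_group shift_gens"
  proof
    fix x assume "x \<in> carrier shift_group"
    then obtain xs where xs: "set xs \<subseteq> enc ` gens"
      "x = foldr (\<lambda>y z. y \<otimes>\<^bsub>shift_group\<^esub> z) xs \<one>\<^bsub>shift_group\<^esub>"
      using shift_group_spelling by metis
    from xs(1) have "foldr (\<lambda>y z. y \<otimes>\<^bsub>shift_group\<^esub> z) xs \<one>\<^bsub>shift_group\<^esub>
        \<in> generate shift_group shift_gens"
      by (induction xs) (auto intro: generate.one generate.eng gen)
    then show "x \<in> generate shift_group shift_gens" using xs by simp
  qed
qed

text \<open>The \<open>LEAST\<close> in \<open>word_length\<close> is attained because some spelling
  exists; later bounds are inductions along such a shortest spelling.\<close>

lemma word_length_spelling:
  assumes "x \<in> carrier shift_group"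
  obtains xs where "length xs = word_length shift_group shift_gens x" "set xs \<subseteq> enc ` gens"
    "foldr (\<lambda>y z. y \<otimes>\<^bsub>shift_group\<^esub> z) xs \<one>\<^bsub>shift_group\<^esub> = x"
proof -
  have "\<exists>n xs. length xs = n \<and> set xs \<subseteq> enc ` gens \<and>
      foldr (\<lambda>y z. y \<otimes>\<^bsub>shift_group\<^esub> z) xs \<one>\<^bsub>shift_group\<^esub> = x"
    using shift_group_spelling[OF assms] by metis
  note ex = this
  have len: "word_length shift_group shift_gens x = (LEAST n. \<exists>xs. length xs = n \<and>
      set xs \<subseteq> enc ` gens \<and> foldr (\<lambda>y z. y \<otimes>\<^bsub>shift_group\<^esub> z) xs \<one>\<^bsub>shift_group\<^esub> = x)"
    unfolding word_length_def symmetric_gens ..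
  have "\<exists>xs. length xs = word_length shift_group shift_gens x \<and> set xs \<subseteq> enc ` gens \<and>
      foldr (\<lambda>y z. y \<otimes>\<^bsub>shift_group\<^esub> z) xs \<one>\<^bsub>shift_group\<^esub> = x"
    unfolding len by (rule LeastI_ex[OF ex])
  then
  show ?thesis by (elim exE conjE) (rule that)
qed

section \<open>Lawlessness\<close>

text \<open>The last entry of \<open>cs\<close> acts first, hence \<open>rev\<close>. After
  \<open>m\<close> steps the highest nonzero coordinate of the image of the basis vector e_0 is
  \<open>m\<close>; as \<open>m\<close> lies in the set used next, coordinate \<open>m + 1\<close>
  becomes 0 + 1, and nothing moves up by more than one place.\<close>

lemma foldr_transvections_leading_term:
  assumes "\<And>m. m < length cs \<Longrightarrow> int m \<in> J (rev cs ! m)"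
  shows "comp_list (map (\<lambda>c. transvections (J c)) cs) (\<lambda>i. of_bool (i = 0)) (int (length cs)) = 1
    \<and> (\<forall>i > int (length cs).
        comp_list (map (\<lambda>c. transvections (J c)) cs) (\<lambda>i. of_bool (i = 0)) i = 0)"
  using assms
proof (induction cs)
  case Nil
  then show ?case by simp
next
  case (Cons c cs)
  have "int m \<in> J (rev cs ! m)" if "m < length cs" for m
    using Cons.prems[of m] that by (simp add: nth_append)
  note IH = Cons.IH[OF this]
  have J: "int (length cs) \<in> J c" using Cons.prems[of "length cs"] by (simp add: nth_append)
  define x where "x = comp_list (map (\<lambda>c. transvections (J c)) cs) (\<lambda>i. of_bool (i = 0))"
  have x: "x (int (length cs)) = 1" "\<And>i. i > int (length cs) \<Longrightarrow> x i = 0"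
    using IH[folded x_def] by simp_all
  have *: "comp_list (map (\<lambda>c. transvections (J c)) (c # cs)) (\<lambda>i. of_bool (i = 0)) = transvections (J c) x"
    unfolding x_def list.map comp_list_Cons comp_apply ..
  have "transvections (J c) x (int (length (c # cs))) = 1 \<and>
      (\<forall>i > int (length (c # cs)). transvections (J c) x i = 0)"
    using x J by (simp add: transvections_apply)
  then show ?case unfolding * .
qed

text \<open>Substituting \<open>y\<^sub>i z\<^sub>i\<close> with involutions \<open>y\<^sub>i, z\<^sub>i\<close> (with indices \<open>2i\<close> and \<open>2i + 1\<close>) for the
  \<open>i\<close>th generator turns a reduced word into a word in which no two neighbours coincide.\<close>

definition split_letter :: "letter \<Rightarrow> nat list" where
  "split_letter l = (if snd l then [2 * fst l, 2 * fst l + 1] else [2 * fst l + 1, 2 * fst l])"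

lemma successively_split:
  "reduced w \<Longrightarrow> successively (\<noteq>) (concat (map split_letter w))"
proof (induction w)
  case (Cons l w)
  show ?case
  proof (cases w)
    case Nil
    then show ?thesis by (simp add: split_letter_def)
  next
    case (Cons m v)
    then have "successively (\<noteq>) (split_letter m @ concat (map split_letter v))"
      using Cons.IH Cons.prems by (simp add: reduced_Cons)
    \<comment> \<open>The last index of \<open>split_letter l\<close> equals the first index of
      \<open>split_letter m\<close> only if \<open>m\<close> is the inverse of \<open>l\<close>, so
      reducedness rules out equal neighbours at the seam.\<close>
    moreover have "m \<noteq> inv_letter l" using Cons Cons.prems by (simp add: reduced_Cons)
    then have "hd (split_letter m) \<noteq> last (split_letter l)"
      using double_not_eq_Suc_double Suc_double_not_eq_double
      by (cases l; cases m) (auto simp: split_letter_def inv_letter_def)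
    moreover obtain p q where "split_letter l = [p, q]" "p \<noteq> q"
      by (cases "snd l") (simp_all add: split_letter_def)
    moreover obtain p' q' where "split_letter m = [p', q']"
      by (cases "snd m") (simp_all add: split_letter_def)
    ultimately show ?thesis by (simp add: Cons)
  qed
qed simp

lemma lawless_shift_group: "lawless shift_group"
proof -
  have False if law: "is_law shift_group k w" for k w
  proof -
    from law have w: "set w \<subseteq> {..<k} \<times> UNIV" "reduced w" "w \<noteq> []"
      and triv: "\<And>g. g \<in> {..<k} \<rightarrow>\<^sub>E carrier shift_group \<Longrightarrow> word_eval shift_group g w = \<one>\<^bsub>shift_group\<^esub>"
      by (auto simp: is_law_def free_group_def)
    define cs where "cs = concat (map split_letter w)"
    \<comment> \<open>\<open>J c\<close> holds the positions, counted from the right, at which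
      \<open>c\<close> occurs. This is the choice that makes every letter push the leading
      coordinate one step up.\<close>
    define J where "J c = {int m | m. m < length cs \<and> rev cs ! m = c}" for c
    define y where "y c = transvections (J c)" for c
    have succ: "successively (\<noteq>) (rev cs)"
      using successively_split[OF w(2)] unfolding cs_def successively_rev
      by (rule successively_mono) auto
    \<comment> \<open>Neighbouring entries of \<open>cs\<close> differ, so one index never occupies
      adjacent positions; hence each \<open>y c\<close> is an involution in the group.\<close>
    have J: "j - 1 \<notin> J c" if "j \<in> J c" for j c
    proof
      assume "j - 1 \<in> J c"
      then obtain m where m: "j - 1 = int m" "rev cs ! m = c" by (auto simp: J_def)
      from that obtain m' where m': "j = int m'" "m' < length cs" "rev cs ! m' = c"
        by (auto simp: J_def)
      have "m' = Suc m" using m(1) m'(1) by linarith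
      then have "rev cs ! m \<noteq> rev cs ! m'"
        using succ m'(2) unfolding successively_conv_nth length_rev by blast
      then show False using m(2) m'(3) by simp
    qed
    have fin: "finite (J c)" for c unfolding J_def by simp
    have y: "y c \<in> maps" "y c \<circ> y c = id" for c
      unfolding y_def by (intro transvections_in_maps transvections_involution fin J; assumption)+
    define g where "g = (\<lambda>i\<in>{..<k}. enc (y (2 * i) \<circ> y (2 * i + 1)))"
    have g: "g \<in> {..<k} \<rightarrow>\<^sub>E carrier shift_group"
      unfolding g_def using comp_in_maps y by auto
    have letter: "dec (eval_letter shift_group g l) = comp_list (map y (split_letter l))"
      if "fst l < k" for l
    proof (cases "snd l")
      case True
      then show ?thesis using that y comp_in_maps by (simp add: eval_letter_def g_def split_letter_def)
    next
      case False
      \<comment> \<open>The inverse of a product of two involutions is the product in the opposite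
        order, matching \<open>split_letter\<close> on inverse letters.\<close>
      have "(y (Suc (2 * fst l)) \<circ> y (2 * fst l)) \<circ> (y (2 * fst l) \<circ> y (Suc (2 * fst l))) = id"
        by (rule ext) (simp add: pointfree_idE[OF y(2)])
      then have "dec (inv\<^bsub>shift_group\<^esub> (enc (y (2 * fst l) \<circ> y (Suc (2 * fst l)))))
          = y (Suc (2 * fst l)) \<circ> y (2 * fst l)"
        by (intro dec_inv comp_in_maps y)
      then show ?thesis using that False by (simp add: eval_letter_def g_def split_letter_def)
    qed
    have "dec (word_eval shift_group g v) = comp_list (map y (concat (map split_letter v)))"
      if "set v \<subseteq> {..<k} \<times> UNIV" for v
      using that
    proof (induction v)
      case Nil
      then show ?case by (simp add: dec_one)
    next
      case (Cons l v)
      have gf: "g \<in> {..<k} \<rightarrow> carrier shift_group" using g by auto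
      have "eval_letter shift_group g l \<in> carrier shift_group"
        "word_eval shift_group g v \<in> carrier shift_group"
        using eval_letter_closed[OF sg.is_group gf] word_eval_closed[OF sg.is_group gf] Cons.prems
        by auto
      moreover have "fst l < k" using Cons.prems by auto
      ultimately show ?case
        using Cons letter[of l] by (simp add: dec_mult comp_list_append)
    qed
    \<comment> \<open>If \<open>w\<close> were a law, this product would fix e_0, whose coordinate
      at \<open>length cs > 0\<close> is 0; the leading term computation gives 1 there.\<close>
    from this[OF w(1)] have "comp_list (map y cs) = id"
      using triv[OF g] by (simp add: cs_def dec_one)
    moreover have "comp_list (map y cs) (\<lambda>i. of_bool (i = 0)) (int (length cs)) = 1"
      unfolding y_def by (rule conjunct1[OF foldr_transvections_leading_term]) (auto simp: J_def)
    moreover have "length cs > 0"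
      using w(3) by (cases w) (auto simp: cs_def split_letter_def)
    ultimately show False by simp
  qed
  then show ?thesis unfolding lawless_def by blast
qed

section \<open>Short words vanishing on a ball\<close>

text \<open>\<open>unitriangular M s h\<close>: up to a shift by \<open>s\<close>, the matrix of \<open>h\<close> is unitriangular and
  differs from the identity only in rows with index in \<open>[-M, M]\<close>.\<close>

definition unitriangular :: "nat \<Rightarrow> int \<Rightarrow> (seq \<Rightarrow> seq) \<Rightarrow> bool" where
  "unitriangular M s h \<longleftrightarrow> \<bar>s\<bar> \<le> int M \<and>
     (\<forall>x y. h (\<lambda>i. x i + y i) = (\<lambda>i. h x i + h y i)) \<and>
     (\<forall>x i. \<bar>i\<bar> > int M \<longrightarrow> h x i = x (i - s)) \<and>
     (\<forall>x c i. (\<forall>j<c. x j = 0) \<longrightarrow> i \<le> c + s \<longrightarrow> h x i = x (i - s))"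

lemma unitriangularI:
  assumes "\<bar>s\<bar> \<le> int M" "\<And>x y. h (\<lambda>i. x i + y i) = (\<lambda>i. h x i + h y i)"
    "\<And>x i. \<bar>i\<bar> > int M \<Longrightarrow> h x i = x (i - s)"
    "\<And>x c i. \<forall>j<c. x j = 0 \<Longrightarrow> i \<le> c + s \<Longrightarrow> h x i = x (i - s)"
  shows "unitriangular M s h"
  unfolding unitriangular_def by (intro conjI allI impI) (rule assms; assumption)+

lemma
  assumes "unitriangular M s h"
  shows unitriangular_shift_bound: "\<bar>s\<bar> \<le> int M"
    and unitriangular_additive: "h (\<lambda>i. x i + y i) = (\<lambda>i. h x i + h y i)"
    and unitriangular_outside: "\<bar>i\<bar> > int M \<Longrightarrow> h x i = x (i - s)"
    and unitriangular_leading: "\<forall>j<c. x j = 0 \<Longrightarrow> i \<le> c + s \<Longrightarrow> h x i = x (i - s)"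
proof -
  note * = assms[unfolded unitriangular_def]
  show "\<bar>s\<bar> \<le> int M" by (rule *[THEN conjunct1])
  note * = *[THEN conjunct2]
  show "h (\<lambda>i. x i + y i) = (\<lambda>i. h x i + h y i)"
    by (rule *[THEN conjunct1, THEN spec, THEN spec])
  note * = *[THEN conjunct2]
  show "h x i = x (i - s)" if "\<bar>i\<bar> > int M"
    by (rule *[THEN conjunct1, THEN spec, THEN spec, THEN mp, OF that])
  show "h x i = x (i - s)" if "\<forall>j<c. x j = 0" "i \<le> c + s"
    by (rule *[THEN conjunct2, THEN spec, THEN spec, THEN spec, THEN mp, THEN mp, OF that])
qed

lemma unitriangular_id: "unitriangular 0 0 id"
  by (rule unitriangularI) auto

text \<open>The bound on the shift makes the row ranges add up: |i| > M + N forces |i - s| > N. For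
  triangularity, if \<open>x\<close> vanishes below \<open>c\<close>, then \<open>g x\<close>
  vanishes below \<open>c + r\<close>, so the condition on \<open>f\<close> applies at
  \<open>c + r\<close>.\<close>

lemma unitriangular_comp:
  assumes f: "unitriangular M s f" and g: "unitriangular N r g"
  shows "unitriangular (M + N) (s + r) (f \<circ> g)"
proof (rule unitriangularI)
  note bounds = unitriangular_shift_bound[OF f] unitriangular_shift_bound[OF g]
  show "\<bar>s + r\<bar> \<le> int (M + N)" using bounds by linarith
  show "(f \<circ> g) (\<lambda>i. x i + y i) = (\<lambda>i. (f \<circ> g) x i + (f \<circ> g) y i)" for x y
    unfolding comp_apply unitriangular_additive[OF g] unitriangular_additive[OF f] ..
  show "(f \<circ> g) x i = x (i - (s + r))" if "\<bar>i\<bar> > int (M + N)" for x i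
  proof -
    have "f (g x) i = g x (i - s)" by (rule unitriangular_outside[OF f]) (use that in linarith)
    moreover have "g x (i - s) = x (i - s - r)"
      by (rule unitriangular_outside[OF g]) (use that bounds in linarith)
    ultimately show ?thesis by (simp add: algebra_simps)
  qed
  show "(f \<circ> g) x i = x (i - (s + r))" if x: "\<forall>j<c. x j = 0" and i: "i \<le> c + (s + r)" for x c i
  proof -
    have gx: "g x j = x (j - r)" if "j \<le> c + r" for j
      by (rule unitriangular_leading[OF g x that])
    have "f (g x) i = g x (i - s)"
      by (rule unitriangular_leading[OF f, of "c + r"]) (simp add: gx x, use i in simp)
    moreover have "g x (i - s) = x (i - s - r)" by (rule gx) (use i in linarith)
    ultimately show ?thesis by (simp add: algebra_simps)
  qed
qed

text \<open>Inverses are recorded with the opposite shift so that the shifts cancel in a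
  commutator.\<close>

lemma unitriangular_gens:
  assumes "f \<in> gens"
  shows "\<exists>s. unitriangular 1 s f \<and> unitriangular 1 (- s) (dec (inv\<^bsub>shift_group\<^esub> (enc f)))"
proof -
  have shift: "unitriangular 1 s (shift s)" if "\<bar>s\<bar> = 1" for s
    by (rule unitriangularI) (use that in \<open>auto simp: shift_def\<close>)
  \<comment> \<open>Only row 1 differs from the identity, so the radius 1 is just enough.\<close>
  have transvection: "unitriangular 1 0 (transvections {0})"
    by (rule unitriangularI) (auto simp: transvections_def fun_eq_iff algebra_simps)
  consider "f = transvections {0}" | "f = shift 1" | "f = shift (- 1)"
    using assms by (auto simp: gens_def)
  then show ?thesis
  proof cases
    case 1
    then show ?thesis
      using transvection enc_transvection_inverse transvections_in_maps[of "{0}"]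
      by (intro exI[of _ 0]) auto
  next
    case 2
    then show ?thesis using shift[of 1] shift[of "- 1"] enc_shift_inverse shift_in_maps
      by (intro exI[of _ 1]) auto
  next
    case 3
    have "dec (inv\<^bsub>shift_group\<^esub> (enc (shift (- 1)))) = shift 1"
      by (rule dec_inv) (auto simp: shift_in_maps shift_comp shift_0)
    then show ?thesis using 3 shift[of 1] shift[of "- 1"]
      by (intro exI[of _ "- 1"]) auto
  qed
qed

lemma unitriangular_word_length:
  assumes "x \<in> carrier shift_group"
  shows "\<exists>s. unitriangular (word_length shift_group shift_gens x) s (dec x) \<and>
    unitriangular (word_length shift_group shift_gens x) (- s) (dec (inv\<^bsub>shift_group\<^esub> x))"
proof -
  have "\<exists>s. unitriangular (length xs) s (dec z) \<and> unitriangular (length xs) (- s) (dec (inv\<^bsub>shift_group\<^esub> z))"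
    if "set xs \<subseteq> enc ` gens" "z = foldr (\<lambda>y z. y \<otimes>\<^bsub>shift_group\<^esub> z) xs \<one>\<^bsub>shift_group\<^esub>" for xs z
    using that
  proof (induction xs arbitrary: z)
    case Nil
    then have "z = \<one>\<^bsub>shift_group\<^esub>" by simp
    then show ?case using unitriangular_id dec_one sg.inv_one by (metis list.size(3) minus_zero)
  next
    case (Cons a xs)
    define v where "v = foldr (\<lambda>y z. y \<otimes>\<^bsub>shift_group\<^esub> z) xs \<one>\<^bsub>shift_group\<^esub>"
    obtain f where f: "f \<in> gens" "a = enc f" using Cons.prems by auto
    have a: "a \<in> carrier shift_group" using f gens_in_maps by auto
    have "set xs \<subseteq> carrier shift_group" using Cons.prems gens_in_maps by auto
    then have v: "v \<in> carrier shift_group" unfolding v_def by (induction xs) auto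
    obtain s where s: "unitriangular (length xs) s (dec v)"
      "unitriangular (length xs) (- s) (dec (inv\<^bsub>shift_group\<^esub> v))"
      using Cons.IH[of v] Cons.prems v_def by auto
    obtain r where r: "unitriangular 1 r (dec a)" "unitriangular 1 (- r) (dec (inv\<^bsub>shift_group\<^esub> a))"
      using unitriangular_gens[OF f(1)] f gens_in_maps by auto
    have "z = a \<otimes>\<^bsub>shift_group\<^esub> v" using Cons.prems v_def by simp
    then have "dec z = dec a \<circ> dec v"
      "dec (inv\<^bsub>shift_group\<^esub> z) = dec (inv\<^bsub>shift_group\<^esub> v) \<circ> dec (inv\<^bsub>shift_group\<^esub> a)"
      using a v by (simp_all add: dec_mult sg.inv_mult_group)
    moreover have "unitriangular (length (a # xs)) (r + s) (dec a \<circ> dec v)"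
      "unitriangular (length (a # xs)) (- (r + s)) (dec (inv\<^bsub>shift_group\<^esub> v) \<circ> dec (inv\<^bsub>shift_group\<^esub> a))"
      using unitriangular_comp[OF r(1) s(1)] unitriangular_comp[OF s(2) r(2)]
      by (simp_all add: algebra_simps)
    ultimately show ?case by metis
  qed
  note spelled = this
  obtain xs where xs: "length xs = word_length shift_group shift_gens x" "set xs \<subseteq> enc ` gens"
    "foldr (\<lambda>y z. y \<otimes>\<^bsub>shift_group\<^esub> z) xs \<one>\<^bsub>shift_group\<^esub> = x"
    by (rule word_length_spelling[OF assms])
  show ?thesis using spelled[OF xs(2) xs(3)[symmetric]] unfolding xs(1) .
qed

text \<open>In characteristic 2, \<open>(1 + D)\<^bsup>2^m\<^esup> = 1 + D\<^bsup>2^m\<^esup>\<close>.\<close>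

lemma unitriangular_power:
  assumes "unitriangular M 0 h" "2 ^ m \<ge> 2 * M + 2"
  shows "h ^^ (2 ^ m) = id"
proof -
  \<comment> \<open>With D = u + 1, which is u - 1 in characteristic 2, \<open>Q s u\<close> says
    that u is additive, that values of D are supported in [s - 1 - M, M], and that D raises the
    lowest nonzero position by at least \<open>s\<close>.\<close>
  define Q where "Q s u \<longleftrightarrow>
     (\<forall>x y. u (\<lambda>i. x i + y i) = (\<lambda>i. u x i + u y i)) \<and>
     (\<forall>x i. i > int M \<longrightarrow> u x i + x i = 0) \<and>
     (\<forall>x i. i < s - 1 - int M \<longrightarrow> u x i + x i = 0) \<and>
     (\<forall>x c i. (\<forall>j<c. x j = 0) \<longrightarrow> i < c + s \<longrightarrow> u x i + x i = 0)"
    for s :: int and u :: "seq \<Rightarrow> seq"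
  have Q1: "Q 1 h"
    unfolding Q_def
  proof (intro conjI allI impI)
    show "h x i + x i = 0" if "\<forall>j<c. x j = 0" "i < c + 1" for x c i
      using unitriangular_leading[OF assms(1) that(1), of i] that(2) by simp
  qed (use unitriangular_additive[OF assms(1)] unitriangular_outside[OF assms(1)] in auto)
  have Q2: "Q (2 * s) (u \<circ> u)" if "Q s u" for s u
  proof -
    have add: "u (\<lambda>i. x i + y i) = (\<lambda>i. u x i + u y i)" for x y using that by (auto simp: Q_def)
    define D where "D x = (\<lambda>i. u x i + x i)" for x
    \<comment> \<open>Expanding D^2 by additivity leaves two copies of u x, which cancel; so
      squaring u squares D.\<close>
    have DD: "u (u x) i + x i = D (D x) i" for x i
      unfolding D_def add by (simp add: algebra_simps)
    have hi: "D x i = 0" if "i > int M" for x i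
      using \<open>Q s u\<close> that by (simp add: Q_def D_def)
    have lo: "D x i = 0" if "i < s - 1 - int M" for x i
      using \<open>Q s u\<close> that by (simp add: Q_def D_def)
    have fil: "D x i = 0" if "\<forall>j<c. x j = 0" "i < c + s" for x c i
    proof -
      have "\<forall>x c i. (\<forall>j<c. x j = 0) \<longrightarrow> i < c + s \<longrightarrow> u x i + x i = 0"
        using \<open>Q s u\<close> by (simp add: Q_def)
      from this[THEN spec, THEN spec, THEN spec, THEN mp, THEN mp, OF that]
      show ?thesis unfolding D_def .
    qed
    show ?thesis unfolding Q_def comp_apply DD
    proof (intro conjI allI impI)
      \<comment> \<open>The inner D x already vanishes below s - 1 - M, and the outer D raises this
        threshold by \<open>s\<close>.\<close>
      show "D (D x) i = 0" if "i < 2 * s - 1 - int M" for x i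
        by (rule fil[of "s - 1 - int M"]) (use lo that in auto)
      show "D (D x) i = 0" if "\<forall>j<c. x j = 0" "i < c + 2 * s" for x c i
        by (rule fil[of "c + s"]) (use fil that in auto)
      show "u (u (\<lambda>i. x i + y i)) = (\<lambda>i. u (u x) i + u (u y) i)" for x y
        unfolding add ..
      show "D (D x) i = 0" if "i > int M" for x i by (rule hi[OF that])
    qed
  qed
  have "Q (2 ^ m) (h ^^ (2 ^ m))"
  proof (induction m)
    case (Suc m)
    show ?case using Q2[OF Suc] unfolding power_Suc mult_2 funpow_add .
  qed (use Q1 in simp)
  note power = this[unfolded Q_def]
  have hi: "\<forall>x i. i > int M \<longrightarrow> (h ^^ (2 ^ m)) x i + x i = 0"
    and lo: "\<forall>x i. i < 2 ^ m - 1 - int M \<longrightarrow> (h ^^ (2 ^ m)) x i + x i = 0"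
    by (rule power[THEN conjunct2, THEN conjunct1]
        power[THEN conjunct2, THEN conjunct2, THEN conjunct1])+
  have big: "(2::int) ^ m \<ge> 2 * int M + 2"
    using assms(2) of_nat_mono[of "2 * M + 2" "2 ^ m", where ?'a = int] by simp
  show ?thesis
  proof (intro ext)
    fix x i
    have "(h ^^ (2 ^ m)) x i + x i = 0"
    proof (cases "i > int M")
      case True
      then show ?thesis using hi by blast
    next
      case False
      \<comment> \<open>The hypothesis gives 2^m - 1 - M > M, so the support interval is empty and D
        vanishes.\<close>
      then have "i < 2 ^ m - 1 - int M" using big by linarith
      then show ?thesis using lo by blast
    qed
    then show "(h ^^ (2 ^ m)) x i = id x i" by (cases "x i") (simp_all add: add_bit_eq_xor)
  qed
qed

section \<open>Powers of a commutator as words\<close>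

definition commutator_power :: "nat \<Rightarrow> letter list" where
  "commutator_power q = concat (replicate q [(0, True), (1, True), (0, False), (1, False)])"

lemma length_commutator_power: "length (commutator_power q) = 4 * q"
  by (simp add: commutator_power_def length_concat sum_list_replicate)

lemma commutator_power_Suc:
  "commutator_power (Suc q) = (0, True) # (1, True) # (0, False) # (1, False) # commutator_power q"
  by (simp add: commutator_power_def)

lemma commutator_power_in_free_group:
  assumes "k \<ge> 2"
  shows "commutator_power q \<in> carrier (free_group k)"
proof -
  \<comment> \<open>The first letter is carried through the induction to check the seam: a block
    ends in the inverse of generator 1 and the next starts with generator 0.\<close>
  have "reduced (commutator_power q) \<and> (q > 0 \<longrightarrow> hd (commutator_power q) = (0, True))"
  proof (induction q)
    case (Suc q)
    then show ?case unfolding commutator_power_Suc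
      by (cases q) (auto simp: reduced_Cons inv_letter_def commutator_power_def)
  qed (simp add: commutator_power_def)
  moreover have "set (commutator_power q) \<subseteq> {..<k} \<times> UNIV"
    using assms by (auto simp: commutator_power_def)
  ultimately show ?thesis by (simp add: free_group_def)
qed

text \<open>If R is the total length of the tuple, the commutator has shift 0 and radius at most 2R,
  so the exponent bound 2M + 2 for radius M becomes 4R + 2.\<close>

lemma word_eval_commutator_power:
  assumes g: "g \<in> {..<k} \<rightarrow>\<^sub>E carrier shift_group" and "k \<ge> 2"
    and len: "2 ^ m \<ge> 4 * (\<Sum>i<k. word_length shift_group shift_gens (g i)) + 2"
  shows "word_eval shift_group g (commutator_power (2 ^ m)) = \<one>\<^bsub>shift_group\<^esub>"
proof -
  let ?l = "word_length shift_group shift_gens"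
  let ?i = "\<lambda>x. inv\<^bsub>shift_group\<^esub> x"
  have c: "g 0 \<in> carrier shift_group" "g 1 \<in> carrier shift_group"
    by (rule PiE_mem[OF g], use assms(2) in simp)+
  obtain s where s: "unitriangular (?l (g 0)) s (dec (g 0))" "unitriangular (?l (g 0)) (- s) (dec (?i (g 0)))"
    using unitriangular_word_length[OF c(1)] by (elim exE conjE) (rule that)
  obtain r where r: "unitriangular (?l (g 1)) r (dec (g 1))" "unitriangular (?l (g 1)) (- r) (dec (?i (g 1)))"
    using unitriangular_word_length[OF c(2)] by (elim exE conjE) (rule that)
  define h where "h = dec (g 0) \<circ> (dec (g 1) \<circ> (dec (?i (g 0)) \<circ> dec (?i (g 1))))"
  have "?l (g 0) + (?l (g 1) + (?l (g 0) + ?l (g 1))) = 2 * (?l (g 0) + ?l (g 1))"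
    "s + (r + (- s + - r)) = 0" by simp_all
  then have h: "unitriangular (2 * (?l (g 0) + ?l (g 1))) 0 h"
    using unitriangular_comp[OF s(1) unitriangular_comp[OF r(1) unitriangular_comp[OF s(2) r(2)]]]
    by (simp only: h_def)
  have eval: "word_eval shift_group g (commutator_power q) \<in> carrier shift_group \<and>
      dec (word_eval shift_group g (commutator_power q)) = h ^^ q" for q
  proof (induction q)
    case 0
    then show ?case using dec_one by (simp add: commutator_power_def id_def)
  next
    case (Suc q)
    let ?w = "word_eval shift_group g (commutator_power q)"
    have eq: "word_eval shift_group g (commutator_power (Suc q)) = g 0 \<otimes>\<^bsub>shift_group\<^esub>
        (g 1 \<otimes>\<^bsub>shift_group\<^esub> (?i (g 0) \<otimes>\<^bsub>shift_group\<^esub> (?i (g 1) \<otimes>\<^bsub>shift_group\<^esub> ?w)))"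
      by (simp add: commutator_power_Suc eval_letter_def)
    show ?case unfolding eq
      using Suc c by (simp only: dec_mult sg.m_closed sg.inv_closed h_def comp_assoc funpow.simps)
  qed
  \<comment> \<open>The word involves only the first two entries of the tuple; the others can only
    increase the total length.\<close>
  have "?l (g 0) + ?l (g 1) = (\<Sum>i\<in>{0, 1}. ?l (g i))" by simp
  also have "\<dots> \<le> (\<Sum>i<k. ?l (g i))" by (rule sum_mono2) (use assms(2) in auto)
  finally have "2 * (2 * (?l (g 0) + ?l (g 1))) + 2 \<le> 4 * (\<Sum>i<k. ?l (g i)) + 2" by simp
  then have "2 ^ m \<ge> 2 * (2 * (?l (g 0) + ?l (g 1))) + 2" using len by (rule order_trans)
  from unitriangular_power[OF h this] eval[of "2 ^ m"] show ?thesis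
    by (metis dec_inject dec_one sg.one_closed)
qed

section \<open>The lower bound\<close>

lemma complexity_attained:
  assumes "lawless G" "w \<in> carrier (free_group k)" "w \<noteq> []"
  obtains g where "g \<in> {..<k} \<rightarrow>\<^sub>E carrier G" "word_eval G g w \<noteq> \<one>\<^bsub>G\<^esub>"
    "complexity G S k w = (\<Sum>i<k. word_length G S (g i))"
proof -
  have "\<not> is_law G k w" using assms(1) by (auto simp: lawless_def)
  then have "\<exists>m. \<exists>g \<in> {..<k} \<rightarrow>\<^sub>E carrier G.
        word_eval G g w \<noteq> \<one>\<^bsub>G\<^esub> \<and> m = (\<Sum>i<k. word_length G S (g i))"
    using assms by (auto simp: is_law_def free_group_def)
  from LeastI_ex[OF this, folded complexity_def] show ?thesis
    by (elim bexE conjE) (rule that)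
qed

lemma complexity_le_lawlessness_growth:
  assumes "w \<in> carrier (free_group k)" "w \<noteq> []" "length w \<le> n"
  shows "complexity G S k w \<le> lawlessness_growth G S k n"
proof -
  have "finite {w. set w \<subseteq> {..<k} \<times> (UNIV :: bool set) \<and> length w \<le> n}"
    by (rule finite_lists_length_le) simp
  then have "finite {w. w \<in> carrier (free_group k) \<and> w \<noteq> \<one>\<^bsub>free_group k\<^esub> \<and> length w \<le> n}"
    by (rule rev_finite_subset) (auto simp: free_group_def)
  then have "finite {complexity G S k w | w.
      w \<in> carrier (free_group k) \<and> w \<noteq> \<one>\<^bsub>free_group k\<^esub> \<and> length w \<le> n}"
    by simp
  then show ?thesis
    unfolding lawlessness_growth_def using assms
    by (intro Max_ge) (auto simp: free_group_def)
qed

text \<open>A tuple of total length 0 consists of identities, on which every word is trivial.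
  Positivity settles small \<open>n\<close> and absorbs the additive constant in the lower
  bound.\<close>

lemma complexity_pos:
  assumes "w \<in> carrier (free_group k)" "w \<noteq> []"
  shows "complexity shift_group shift_gens k w > 0"
proof (rule ccontr)
  obtain g where g: "g \<in> {..<k} \<rightarrow>\<^sub>E carrier shift_group" "word_eval shift_group g w \<noteq> \<one>\<^bsub>shift_group\<^esub>"
    "complexity shift_group shift_gens k w = (\<Sum>i<k. word_length shift_group shift_gens (g i))"
    by (rule complexity_attained[OF lawless_shift_group assms])
  assume "\<not> complexity shift_group shift_gens k w > 0"
  then have zero: "word_length shift_group shift_gens (g i) = 0" if "i < k" for i
    using g(3) that by simp
  have one: "g i = \<one>\<^bsub>shift_group\<^esub>" if "i < k" for i
  proof -
    have "g i \<in> carrier shift_group" using g(1) that by auto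
    then obtain xs where "length xs = word_length shift_group shift_gens (g i)"
      "foldr (\<lambda>y z. y \<otimes>\<^bsub>shift_group\<^esub> z) xs \<one>\<^bsub>shift_group\<^esub> = g i"
      by (rule word_length_spelling)
    then show ?thesis using zero[OF that] by simp
  qed
  have "word_eval shift_group g v = \<one>\<^bsub>shift_group\<^esub>" if "set v \<subseteq> {..<k} \<times> UNIV" for v
    using that
  proof (induction v)
    case (Cons l v)
    then have "eval_letter shift_group g l = \<one>\<^bsub>shift_group\<^esub>"
      using one[of "fst l"] by (auto simp: eval_letter_def)
    then show ?case using Cons by simp
  qed simp
  moreover have "set w \<subseteq> {..<k} \<times> UNIV" using assms(1) by (simp add: free_group_def)
  ultimately show False using g(2) by blast
qed

theorem theorem1p3:
  fixes k :: nat
  assumes "k \<ge> 2"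
  shows "\<exists>(\<Gamma> :: nat monoid) (S :: nat set) (c :: real).
           group \<Gamma> \<and> finite S \<and> S \<subseteq> carrier \<Gamma> \<and> generate \<Gamma> S = carrier \<Gamma> \<and>
           lawless \<Gamma> \<and> c > 0 \<and>
           (\<forall>n::nat. n \<ge> 1 \<longrightarrow> real (lawlessness_growth \<Gamma> S k n) \<ge> c * real n)"
proof (intro exI conjI allI impI)
  show "group shift_group" by (rule sg.is_group)
  show "finite shift_gens" by (simp add: shift_gens_def)
  show "shift_gens \<subseteq> carrier shift_group" by (rule shift_gens_subset)
  show "generate shift_group shift_gens = carrier shift_group" by (rule generate_shift_gens)
  show "lawless shift_group" by (rule lawless_shift_group)
  \<comment> \<open>The factor 40 is 8 times 5: n < 8 * 2^m by the choice of \<open>m\<close>, and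
    2^m \<le> 4 \<chi> + 1 \<le> 5 \<chi> for the complexity \<chi> \<ge> 1.\<close>
  show "(0::real) < 1 / 40" by simp
  fix n :: nat assume n: "n \<ge> 1"
  have "n \<le> 40 * lawlessness_growth shift_group shift_gens k n"
  proof (cases "n < 4")
    case True
    have w: "[(0, True)] \<in> carrier (free_group k)" "[(0 :: nat, True)] \<noteq> []"
      using assms by (auto simp: free_group_def reduced_Cons)
    have "length [(0 :: nat, True)] \<le> n" using n by simp
    then show ?thesis
      using complexity_pos[OF w] complexity_le_lawlessness_growth[OF w, of n shift_group shift_gens] True
      by linarith
  next
    case False
    \<comment> \<open>The commutator power with exponent 2^m has length 4 * 2^m; the largest
      \<open>m\<close> for which this is at most \<open>n\<close> is taken.\<close>
    then have "n div 4 \<ge> 1" by linarith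
    then obtain m where m: "2 ^ m \<le> n div 4" "n div 4 < 2 ^ Suc m"
      using ex_power_ivl1[of 2 "n div 4"] by auto
    let ?w = "commutator_power (2 ^ m)"
    have w: "?w \<in> carrier (free_group k)" by (rule commutator_power_in_free_group[OF assms])
    have len: "length ?w = 4 * 2 ^ m" by (rule length_commutator_power)
    then have ne: "?w \<noteq> []" by (metis length_0_conv mult_eq_0_iff power_eq_0_iff zero_neq_numeral)
    obtain g where g: "g \<in> {..<k} \<rightarrow>\<^sub>E carrier shift_group" "word_eval shift_group g ?w \<noteq> \<one>\<^bsub>shift_group\<^esub>"
      "complexity shift_group shift_gens k ?w = (\<Sum>i<k. word_length shift_group shift_gens (g i))"
      by (rule complexity_attained[OF lawless_shift_group w ne])
    \<comment> \<open>Otherwise the word would vanish on the tuple \<open>g\<close> that realises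
      its complexity.\<close>
    have "2 ^ m < 4 * complexity shift_group shift_gens k ?w + 2"
      using word_eval_commutator_power[OF g(1) assms, of m] g(2,3) by linarith
    moreover have "complexity shift_group shift_gens k ?w > 0" by (rule complexity_pos[OF w ne])
    moreover have "n < 8 * 2 ^ m" using m(2) by simp
    moreover have "complexity shift_group shift_gens k ?w \<le> lawlessness_growth shift_group shift_gens k n"
      by (rule complexity_le_lawlessness_growth[OF w ne]) (use len m(1) in linarith)
    ultimately show ?thesis by linarith
  qed
  then show "1 / 40 * real n \<le> real (lawlessness_growth shift_group shift_gens k n)"
    by (simp add: field_simps flip: of_nat_mult)
qed

end
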